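(* Let $H$ be a complex Hilbert space, let $A\in\mathcal{B}(H)$ be positive, and let $F:\mathcal{D}(F)\subseteq H\to H$ be a densely defined linear operator admitting an $A$-adjoint $F^{\#}$. Then $\mathcal{R}(F)^{\perp_A}=\mathcal{N}(F^{\#})$, where $\mathcal{R}(F)^{\perp_A}=\{f\in H:\langle f,h\rangle_A=0\text{ for every }h\in\mathcal{R}(F)\}$.
   Context: Inner products are linear in the first variable. For a positive bounded operator $A$ on $H$, $\langle f,g\rangle_A=\langle Af,g\rangle$. $\mathcal{D}(\cdot)$, $\mathcal{R}(\cdot)$, $\mathcal{N}(\cdot)$ denote domain, range and null space; $T^*$ is the Hilbert-space adjoint. $A$-adjoint: let $T:\mathcal{D}(T)\subseteq H\to H$ be densely defined and closable with $\mathcal{R}(T^*A)\subseteq\mathcal{R}(A)$ (in this case one says $T$ admits an $A$-adjoint). The $A$-adjoint $T^{\#}$ has domain the set of $f\in H$ for which there is a unique $g_f\in\overline{\mathcal{R}(A)}$ with $\langle Th,f\rangle_A=\langle h,g_f\rangle_A$ for every $h\in\mathcal{D}(T)$, and $T^{\#}f=g_f$. It is the unique operator with $AT^{\#}=T^*A$ (equality including domains) and $\mathcal{R}(T^{\#})\subseteq\overline{\mathcal{R}(A)}$. *)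

theory Defs
  imports "HOL-Analysis.Analysis"
begin

class complex_vector = real_vector +
  fixes scaleC :: "complex \<Rightarrow> 'a \<Rightarrow> 'a" (infixr "*\<^sub>C" 75)
  assumes scaleC_add_right: "c *\<^sub>C (x + y) = c *\<^sub>C x + c *\<^sub>C y"
    and scaleC_add_left: "(c + d) *\<^sub>C x = c *\<^sub>C x + d *\<^sub>C x"
    and scaleC_scaleC: "c *\<^sub>C (d *\<^sub>C x) = (c * d) *\<^sub>C x"
    and scaleC_of_real: "complex_of_real r *\<^sub>C x = r *\<^sub>R x"

global_interpretation complex_vector: vector_space "scaleC :: complex \<Rightarrow> 'a \<Rightarrow> 'a::complex_vector"
proof
  show "1 *\<^sub>C x = x" for x :: 'a
    using scaleC_of_real[of 1 x] by simp
qed (simp_all add: scaleC_add_right scaleC_add_left scaleC_scaleC)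

text \<open>The inner product is linear in the first variable.\<close>

class complex_inner = complex_vector + real_normed_vector +
  fixes cinner :: "'a \<Rightarrow> 'a \<Rightarrow> complex"
  assumes cinner_commute: "cinner x y = cnj (cinner y x)"
    and cinner_add_left: "cinner (x + y) z = cinner x z + cinner y z"
    and cinner_scaleC_left: "cinner (c *\<^sub>C x) y = c * cinner x y"
    and cinner_ge_zero: "0 \<le> Re (cinner x x)"
    and cinner_eq_zero_iff: "cinner x x = 0 \<longleftrightarrow> x = 0"
    and norm_eq_sqrt_cinner: "norm x = sqrt (Re (cinner x x))"

class chilbert_space = complex_inner + complete_space

instantiation complex :: chilbert_space
begin

definition scaleC_complex :: "complex \<Rightarrow> complex \<Rightarrow> complex" where
  "scaleC_complex c x = c * x"

definition cinner_complex :: "complex \<Rightarrow> complex \<Rightarrow> complex" where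
  "cinner_complex x y = x * cnj y"

instance
  by standard
    (auto simp: scaleC_complex_def cinner_complex_def algebra_simps scaleR_conv_of_real
      cmod_def power2_eq_square)

end

definition bounded_clinear :: "('a::complex_inner \<Rightarrow> 'a) \<Rightarrow> bool" where
  "bounded_clinear A \<longleftrightarrow> bounded_linear A \<and> (\<forall>c x. A (c *\<^sub>C x) = c *\<^sub>C A x)"

definition positive_operator :: "('a::complex_inner \<Rightarrow> 'a) \<Rightarrow> bool" where
  "positive_operator A \<longleftrightarrow> (\<forall>f. cinner (A f) f \<in> \<real>\<^sub>\<ge>\<^sub>0)"

text \<open>
  A not everywhere defined operator T is a partial function: its domain is \<open>dom T\<close>, its range
  is \<open>ran T\<close>, its graph is \<open>Map.graph T\<close>, and \<open>S\<close> extends \<open>T\<close> iff \<open>T \<subseteq>\<^sub>m S\<close>.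
  For an everywhere defined \<open>A\<close>, the product \<open>S A\<close> with its natural domain
  is \<open>S \<circ> A\<close>.
\<close>

definition linear_operator :: "('a::complex_vector \<rightharpoonup> 'a) \<Rightarrow> bool" where
  "linear_operator T \<longleftrightarrow> complex_vector.subspace (dom T) \<and>
    (\<forall>x\<in>dom T. \<forall>y\<in>dom T. the (T (x + y)) = the (T x) + the (T y)) \<and>
    (\<forall>c. \<forall>x\<in>dom T. the (T (c *\<^sub>C x)) = c *\<^sub>C the (T x))"

definition null_space :: "('a::complex_vector \<rightharpoonup> 'a) \<Rightarrow> 'a set" where
  "null_space T = {f. T f = Some 0}"

definition densely_defined :: "('a::complex_inner \<rightharpoonup> 'a) \<Rightarrow> bool" where
  "densely_defined T \<longleftrightarrow> closure (dom T) = UNIV"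

definition closable :: "('a::complex_inner \<rightharpoonup> 'a) \<Rightarrow> bool" where
  "closable T \<longleftrightarrow> (\<exists>S. linear_operator S \<and> closed (Map.graph S) \<and> T \<subseteq>\<^sub>m S)"

text \<open>For densely defined \<open>T\<close> there is at most one such \<open>g\<close>, so that the
  uniqueness requirement does not restrict the domain of the adjoint.\<close>

definition adjoint_operator :: "('a::complex_inner \<rightharpoonup> 'a) \<Rightarrow> ('a \<rightharpoonup> 'a)" where
  "adjoint_operator T f =
    (if \<exists>!g. \<forall>h\<in>dom T. cinner (the (T h)) f = cinner h g
     then Some (THE g. \<forall>h\<in>dom T. cinner (the (T h)) f = cinner h g)
     else None)"

definition A_inner :: "('a::complex_inner \<Rightarrow> 'a) \<Rightarrow> 'a \<Rightarrow> 'a \<Rightarrow> complex" where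
  "A_inner A f g = cinner (A f) g"

definition A_orthogonal :: "('a::complex_inner \<Rightarrow> 'a) \<Rightarrow> 'a set \<Rightarrow> 'a set" where
  "A_orthogonal A S = {f. \<forall>h\<in>S. A_inner A f h = 0}"

definition admits_A_adjoint :: "('a::complex_inner \<Rightarrow> 'a) \<Rightarrow> ('a \<rightharpoonup> 'a) \<Rightarrow> bool" where
  "admits_A_adjoint A T \<longleftrightarrow>
    densely_defined T \<and> closable T \<and> ran (adjoint_operator T \<circ> A) \<subseteq> range A"

definition A_adjoint :: "('a::complex_inner \<Rightarrow> 'a) \<Rightarrow> ('a \<rightharpoonup> 'a) \<Rightarrow> ('a \<rightharpoonup> 'a)" where
  "A_adjoint A T f =
    (if \<exists>!g. g \<in> closure (range A) \<and> (\<forall>h\<in>dom T. A_inner A (the (T h)) f = A_inner A h g)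
     then Some (THE g. g \<in> closure (range A) \<and>
       (\<forall>h\<in>dom T. A_inner A (the (T h)) f = A_inner A h g))
     else None)"

end

theory Submission
  imports Defs
begin

text \<open>A positive operator on a complex space is symmetric, so \<open>f\<close> is \<open>A\<close>-orthogonal to the range
  of \<open>F\<close> iff \<open>g = 0\<close> satisfies the equation defining \<open>F\<^sup># f\<close>. That \<open>0\<close> is then the unique solution in
  the closure of the range of \<open>A\<close> follows by density: another solution \<open>g\<close> is orthogonal to \<open>A h\<close>
  for all \<open>h\<close> in the domain of \<open>F\<close>, hence to the closure of the range of \<open>A\<close>, hence to itself.\<close>

lemma cinner_zero_left [simp]: "cinner 0 (x::'a::complex_inner) = 0"
  using cinner_add_left[of 0 0 x] by simp

lemma cinner_zero_right [simp]: "cinner (x::'a::complex_inner) 0 = 0"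
  by (subst cinner_commute) simp

lemma cinner_add_right: "cinner (x::'a::complex_inner) (y + z) = cinner x y + cinner x z"
  by (metis cinner_add_left cinner_commute complex_cnj_add)

lemma cinner_scaleC_right: "cinner (x::'a::complex_inner) (c *\<^sub>C y) = cnj c * cinner x y"
  by (metis cinner_commute cinner_scaleC_left complex_cnj_mult)

text \<open>Reduces continuity of the inner product to continuity of the norm.\<close>

lemma Re_cinner_polarization:
  "Re (cinner (x::'a::complex_inner) y) = ((norm (x + y))\<^sup>2 - (norm x)\<^sup>2 - (norm y)\<^sup>2) / 2"
proof -
  have sq: "(norm z)\<^sup>2 = Re (cinner z z)" for z :: 'a
    by (simp add: norm_eq_sqrt_cinner cinner_ge_zero)
  have "Re (cinner y x) = Re (cinner x y)"
    by (subst cinner_commute) simp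
  then show ?thesis
    unfolding sq by (simp add: cinner_add_left cinner_add_right)
qed

lemma continuous_on_cinner_left:
  fixes f :: "'b::topological_space \<Rightarrow> 'a::complex_inner"
  assumes "continuous_on S f"
  shows "continuous_on S (\<lambda>x. cinner (f x) y)"
proof -
  have Re: "continuous_on S (\<lambda>x. Re (cinner (f x) z))" for z
    unfolding Re_cinner_polarization by (intro continuous_intros assms) simp
  \<comment> \<open>Conjugate linearity in the second slot turns the imaginary part into the real
    part against \<open>\<i> *\<^sub>C y\<close>.\<close>
  have "cinner x y = Complex (Re (cinner x y)) (Re (cinner x (\<i> *\<^sub>C y)))" for x :: 'a
    by (simp add: cinner_scaleC_right)
  then show ?thesis
    using continuous_on_Complex[OF Re[of y] Re[of "\<i> *\<^sub>C y"]] by simp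
qed

lemma closed_cinner_left_eq_zero:
  fixes f :: "'b::topological_space \<Rightarrow> 'a::complex_inner"
  assumes "continuous_on UNIV f"
  shows "closed {x. cinner (f x) y = 0}"
  by (intro closed_Collect_eq continuous_on_cinner_left assms continuous_on_const)

lemma A_inner_commute:
  assumes "bounded_clinear A" and "positive_operator A"
  shows "A_inner A x y = cnj (A_inner A y x)"
proof -
  have add: "A (u + v) = A u + A v" and scale: "A (c *\<^sub>C u) = c *\<^sub>C A u" for u v c
    using assms(1) by (auto simp: bounded_clinear_def linear_simps)
  have "Im (cinner (A u) u) = 0" for u
    using assms(2) by (simp add: positive_operator_def complex_nonneg_Reals_iff)
  note * = this[of "u + v" for u v] this
  have "Im (cinner (A u) v) + Im (cinner (A v) u) = 0" for u v
    using *(1)[of u v] *(2)[of u] *(2)[of v] by (simp add: add cinner_add_left cinner_add_right)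
  \<comment> \<open>The first instance compares the imaginary parts of the two sides; replacing
    \<open>x\<close> by \<open>\<i> *\<^sub>C x\<close> compares their real parts.\<close>
  from this[of x y] this[of "\<i> *\<^sub>C x" y]
  show ?thesis
    by (simp add: A_inner_def complex_eq_iff scale cinner_scaleC_left cinner_scaleC_right)
qed

lemma eq_zero_if_A_inner_dense_eq_zero:
  assumes A: "bounded_clinear A" and D: "closure D = UNIV"
    and g: "g \<in> closure (range A)" and zero: "\<And>h. h \<in> D \<Longrightarrow> A_inner A h g = 0"
  shows "g = 0"
proof -
  have "continuous_on UNIV A"
    using A by (simp add: bounded_clinear_def linear_continuous_on)
  \<comment> \<open>A closed set containing the dense set \<open>D\<close> is everything, so
    \<open>g\<close> is orthogonal to all of \<open>range A\<close>.\<close>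
  then have "closure D \<subseteq> {h. cinner (A h) g = 0}"
    using zero by (intro closure_minimal closed_cinner_left_eq_zero) (auto simp: A_inner_def)
  then have "closure (range A) \<subseteq> {x. cinner x g = 0}"
    using D by (intro closure_minimal closed_cinner_left_eq_zero continuous_on_id) auto
  then show ?thesis
    using g by (auto simp: cinner_eq_zero_iff)
qed

lemma A_adjoint_eq_Some_zero_iff:
  assumes "bounded_clinear A" and "densely_defined T"
  shows "A_adjoint A T f = Some 0 \<longleftrightarrow> (\<forall>h\<in>dom T. A_inner A (the (T h)) f = 0)"
proof -
  define P where
    "P g \<longleftrightarrow> g \<in> closure (range A) \<and> (\<forall>h\<in>dom T. A_inner A (the (T h)) f = A_inner A h g)" for g
  have adj: "A_adjoint A T f = (if \<exists>!g. P g then Some (THE g. P g) else None)"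
    by (simp add: A_adjoint_def P_def)
  have "A 0 = 0"
    using assms(1) by (simp add: bounded_clinear_def linear_simps)
  then have "0 \<in> closure (range A)"
    by (metis closure_subset rangeI subsetD)
  then have P0: "P 0 \<longleftrightarrow> (\<forall>h\<in>dom T. A_inner A (the (T h)) f = 0)"
    by (simp add: P_def A_inner_def)
  \<comment> \<open>Once \<open>0\<close> is a solution, every solution \<open>g\<close> has
    \<open>A_inner A h g = 0\<close> on the dense domain of \<open>T\<close>.\<close>
  have "g = 0" if "P 0" "P g" for g
    using that assms eq_zero_if_A_inner_dense_eq_zero[of A "dom T" g]
    by (simp add: P0 densely_defined_def) (simp add: P_def)
  then have "A_adjoint A T f = Some 0 \<longleftrightarrow> P 0"
    unfolding adj by (auto split: if_splits intro: the_equality) (metis theI)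
  then show ?thesis
    using P0 by simp
qed

theorem theorem3p13:
  fixes A :: "'a::chilbert_space \<Rightarrow> 'a" and F :: "'a \<rightharpoonup> 'a"
  assumes "bounded_clinear A" and "positive_operator A"
    and "linear_operator F" and "densely_defined F" and "admits_A_adjoint A F"
  shows "A_orthogonal A (ran F) = null_space (A_adjoint A F)"
proof -
  have "ran F = (\<lambda>h. the (F h)) ` dom F"
    by (force simp: ran_def dom_def image_iff)
  \<comment> \<open>\<open>A_orthogonal\<close> puts \<open>f\<close> in the first slot, the
    \<open>A\<close>-adjoint puts it in the second.\<close>
  moreover have "A_inner A f h = 0 \<longleftrightarrow> A_inner A h f = 0" for f h
    using A_inner_commute[OF assms(1,2)] by (metis complex_cnj_zero)
  ultimately show ?thesis
    by (auto simp: A_orthogonal_def null_space_def A_adjoint_eq_Some_zero_iff[OF assms(1,4)])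
qed

end
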